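(* Consider the nonparametric instrumental variables model $Y=\phi_0(Z)+U$ with $\mathbb{E}\{U|W\}=0$, where $Z\in\mathbb{R}^p$ and $W\in\mathbb{R}^q$, and a sample $(Y_i,Z_i,W_i)_{i=1}^n$. Let $\omega(\cdot)=\exp(\mathbf{i}\,\cdot)$ and let $\mu$ be a positive finite measure on $\mathcal{T}\subset\mathbb{R}^q$ with a symmetric Fourier transform, i.e. its characteristic function $\mathcal{F}_\mu(w)=\int\exp(\mathbf{i}w^Tt)\mu(dt)$ satisfies $\mathcal{F}_\mu(w)=\mathcal{F}_\mu(-w)$. Define $$\widehat\phi=a\sum_{l=0}^m(I-a\widehat A_Z^*\widehat A_Z)^l\widehat A_Z^*\widehat s,\qquad\widetilde\phi=a\sum_{l=0}^m(I-a\widehat T_Z^*\widehat T_Z)^l\widehat T_Z^*\widehat r,$$ with $\widehat s,\widehat A_Z,\widehat A_Z^*$ (no smoothing on the instruments $W$) and $\widehat r,\widehat T_Z,\widehat T_Z^*$ (kernel smoothing on $W$ with kernel $K_W$ and bandwidth $h_W$) as defined in the context. If the bandwidth $h_W$ is kept fixed and $$\frac{1}{h_W^q}(K_W\ast K_W)\Big(\frac{\cdot}{h_W}\Big)=\mathcal{F}_\mu,$$ where $K_W\ast K_W$ denotes the convolution of $K_W$ with itself, then $\widehat A_Z^*\widehat s=\widehat T_Z^*\widehat r$ and $\widehat A_Z^*\widehat A_Z=\widehat T_Z^*\widehat T_Z$, and hence $\widehat\phi=\widetilde\phi$.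
   Context: $\mathbf{i}$ is the imaginary unit. $\mathcal{T}$ contains a neighborhood of the origin. $\pi$ is a density on $\mathbb{R}^p$, strictly positive on the support of $Z$, such that the density $f_Z$ of $Z$ satisfies $f_Z/\pi\in L^2_\pi(\mathbb{R}^p)$; $L^2_\pi(\mathbb{R}^p)$ and $L^2_\mu(\mathcal{T})$ are the (complex) spaces of functions square integrable with respect to $\pi(z)dz$ and $\mu$. $m\in\mathbb{N}$ is the regularization parameter, and $a$ is a fixed constant with $0<a<1/\|A_Z\|_{op}^2$, where $A_Z:L^2_\pi(\mathbb{R}^p)\to L^2_\mu(\mathcal{T})$, $(A_Z\phi)(t)=\mathbb{E}\{\phi(Z)\omega(W^Tt)\}$, and $\|\cdot\|_{op}$ is the operator norm. $K$ is a symmetric kernel on $\mathbb{R}^p$ and $h$ a bandwidth (for $Z$), with $K((\cdot-Z_i)/h)/\pi\in L^2_\pi(\mathbb{R}^p)$; $K_W$ is a kernel on $\mathbb{R}^q$ and $h_W$ a bandwidth (for $W$). Estimators without smoothing on $W$: $\widehat s(t)=\frac1n\sum_{i=1}^nY_i\,\omega(W_i^Tt)$; $\widehat k(z,t)=\frac{1}{nh^p}\sum_{i=1}^n\omega(W_i^Tt)K\big(\frac{z-Z_i}{h}\big)$; $\widehat A_Z:L^2_\pi(\mathbb{R}^p)\to L^2_\mu(\mathcal{T})$, $(\widehat A_Z\phi)(t)=\int\phi(z)\widehat k(z,t)dz$; its Hilbert adjoint $\widehat A_Z^*:L^2_\mu(\mathcal{T})\to L^2_\pi(\mathbb{R}^p)$,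 $(\widehat A_Z^*\psi)(z)=\int\psi(t)\frac{\overline{\widehat k}(z,t)}{\pi(z)}\mu(dt)$, where the bar denotes complex conjugation. Estimators with smoothing on $W$: $\widehat f_{WZ}(w,z)=\frac{1}{nh^ph_W^q}\sum_{i=1}^nK\big(\frac{z-Z_i}{h}\big)K_W\big(\frac{w-W_i}{h_W}\big)$; $\widehat r(w)=\frac{1}{nh_W^q}\sum_{i=1}^nY_iK_W\big(\frac{w-W_i}{h_W}\big)$; $(\widehat T_Z\varphi)(w)=\int\varphi(z)\widehat f_{WZ}(w,z)dz$ for $\varphi\in L^2_\pi(\mathbb{R}^p)$; $(\widehat T_Z^*\psi)(z)=\int\psi(w)\widehat f_{WZ}(w,z)\frac{1}{\pi(z)}dw$ for $\psi\in L^2(\mathbb{R}^q)$. *)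

theory Defs
  imports "HOL-Probability.Probability"
begin

section \<open>Function spaces and operator norm\<close>

text \<open>
  Square integrable complex functions are represented by actual functions; equality in the
  corresponding Hilbert space is equality almost everywhere.
\<close>

definition L2 :: "'a measure \<Rightarrow> ('a \<Rightarrow> complex) set" where
  "L2 M = {f \<in> borel_measurable M. integrable M (\<lambda>x. (norm (f x))\<^sup>2)}"

definition L2_norm :: "'a measure \<Rightarrow> ('a \<Rightarrow> complex) \<Rightarrow> real" where
  "L2_norm M f = sqrt (\<integral>x. (norm (f x))\<^sup>2 \<partial>M)"

text \<open>
  The norm takes values in the extended nonnegative reals, so that an unbounded operator has
  norm \<open>\<infinity>\<close> and \<open>1 / (op_norm M N A)\<^sup>2\<close> is \<open>\<infinity>\<close> for the zero operator.
\<close>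

definition op_norm ::
  "'a measure \<Rightarrow> 'b measure \<Rightarrow> (('a \<Rightarrow> complex) \<Rightarrow> 'b \<Rightarrow> complex) \<Rightarrow> ennreal" where
  "op_norm M N A = (SUP \<phi> \<in> {\<phi> \<in> L2 M. L2_norm M \<phi> \<le> 1}. ennreal (L2_norm N (A \<phi>)))"

abbreviation weighted :: "('a::euclidean_space \<Rightarrow> real) \<Rightarrow> 'a measure" where
  "weighted \<pi> \<equiv> density lborel (\<lambda>z. ennreal (\<pi> z))"

section \<open>Kernels, densities, Fourier transforms\<close>

definition prob_density :: "('a::euclidean_space \<Rightarrow> real) \<Rightarrow> bool" where
  "prob_density f \<longleftrightarrow> (\<forall>x. 0 \<le> f x) \<and> integrable lborel f \<and> (\<integral>x. f x \<partial>lborel) = 1"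

text \<open>As usual for smoothing kernels, no sign condition is imposed.\<close>

definition smoothing_kernel :: "('a::euclidean_space \<Rightarrow> real) \<Rightarrow> bool" where
  "smoothing_kernel K \<longleftrightarrow> integrable lborel K \<and> (\<integral>x. K x \<partial>lborel) = 1"

definition convolve ::
  "('a::euclidean_space \<Rightarrow> real) \<Rightarrow> ('a \<Rightarrow> real) \<Rightarrow> 'a \<Rightarrow> real" where
  "convolve f g x = (\<integral>u. f u * g (x - u) \<partial>lborel)"

definition fourier :: "('a::euclidean_space) measure \<Rightarrow> 'a \<Rightarrow> complex" where
  "fourier \<mu> w = (\<integral>t. iexp (w \<bullet> t) \<partial>\<mu>)"

definition measure_support :: "('a::topological_space) measure \<Rightarrow> 'a set" where
  "measure_support N = {x. \<forall>S. open S \<and> x \<in> S \<longrightarrow> emeasure N S > 0}"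

section \<open>The population operator\<close>

definition A_op ::
  "'o measure \<Rightarrow> ('o \<Rightarrow> real^'p) \<Rightarrow> ('o \<Rightarrow> real^'q) \<Rightarrow> (real^'p \<Rightarrow> complex) \<Rightarrow> real^'q \<Rightarrow> complex" where
  "A_op M Z W \<phi> t = (\<integral>x. \<phi> (Z x) * iexp (W x \<bullet> t) \<partial>M)"

section \<open>Estimators without smoothing on the instruments\<close>

text \<open>Here \<open>y\<close>, \<open>z\<close>, \<open>w\<close> are the observed values of the sample, indexed by \<open>{1..n}\<close>.\<close>

definition s_hat :: "nat \<Rightarrow> (nat \<Rightarrow> real) \<Rightarrow> (nat \<Rightarrow> real^'q) \<Rightarrow> real^'q \<Rightarrow> complex" where
  "s_hat n y w t = complex_of_real (1 / real n) *
     (\<Sum>i=1..n. complex_of_real (y i) * iexp (w i \<bullet> t))"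

definition k_hat ::
  "nat \<Rightarrow> real \<Rightarrow> (real^'p \<Rightarrow> real) \<Rightarrow> (nat \<Rightarrow> real^'p) \<Rightarrow> (nat \<Rightarrow> real^'q) \<Rightarrow>
   real^'p \<Rightarrow> real^'q \<Rightarrow> complex" where
  "k_hat n h K z w v t = complex_of_real (1 / (real n * h ^ CARD('p))) *
     (\<Sum>i=1..n. iexp (w i \<bullet> t) * complex_of_real (K ((v - z i) /\<^sub>R h)))"

definition A_hat ::
  "nat \<Rightarrow> real \<Rightarrow> (real^'p \<Rightarrow> real) \<Rightarrow> (nat \<Rightarrow> real^'p) \<Rightarrow> (nat \<Rightarrow> real^'q) \<Rightarrow>
   (real^'p \<Rightarrow> complex) \<Rightarrow> real^'q \<Rightarrow> complex" where
  "A_hat n h K z w \<phi> t = (\<integral>v. \<phi> v * k_hat n h K z w v t \<partial>lborel)"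

definition A_hat_adj ::
  "(real^'q) measure \<Rightarrow> (real^'p \<Rightarrow> real) \<Rightarrow>
   nat \<Rightarrow> real \<Rightarrow> (real^'p \<Rightarrow> real) \<Rightarrow> (nat \<Rightarrow> real^'p) \<Rightarrow> (nat \<Rightarrow> real^'q) \<Rightarrow>
   (real^'q \<Rightarrow> complex) \<Rightarrow> real^'p \<Rightarrow> complex" where
  "A_hat_adj \<mu> \<pi> n h K z w \<psi> v =
     (\<integral>t. \<psi> t * (cnj (k_hat n h K z w v t) / complex_of_real (\<pi> v)) \<partial>\<mu>)"

section \<open>Estimators with smoothing on the instruments\<close>

definition f_hat ::
  "nat \<Rightarrow> real \<Rightarrow> real \<Rightarrow> (real^'p \<Rightarrow> real) \<Rightarrow> (real^'q \<Rightarrow> real) \<Rightarrow>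
   (nat \<Rightarrow> real^'p) \<Rightarrow> (nat \<Rightarrow> real^'q) \<Rightarrow> real^'q \<Rightarrow> real^'p \<Rightarrow> real" where
  "f_hat n h hW K KW z w u v = 1 / (real n * h ^ CARD('p) * hW ^ CARD('q)) *
     (\<Sum>i=1..n. K ((v - z i) /\<^sub>R h) * KW ((u - w i) /\<^sub>R hW))"

definition r_hat ::
  "nat \<Rightarrow> real \<Rightarrow> (real^'q \<Rightarrow> real) \<Rightarrow> (nat \<Rightarrow> real) \<Rightarrow> (nat \<Rightarrow> real^'q) \<Rightarrow> real^'q \<Rightarrow> complex" where
  "r_hat n hW KW y w u = complex_of_real (1 / (real n * hW ^ CARD('q)) *
     (\<Sum>i=1..n. y i * KW ((u - w i) /\<^sub>R hW)))"

definition T_hat ::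
  "nat \<Rightarrow> real \<Rightarrow> real \<Rightarrow> (real^'p \<Rightarrow> real) \<Rightarrow> (real^'q \<Rightarrow> real) \<Rightarrow>
   (nat \<Rightarrow> real^'p) \<Rightarrow> (nat \<Rightarrow> real^'q) \<Rightarrow> (real^'p \<Rightarrow> complex) \<Rightarrow> real^'q \<Rightarrow> complex" where
  "T_hat n h hW K KW z w \<phi> u =
     (\<integral>v. \<phi> v * complex_of_real (f_hat n h hW K KW z w u v) \<partial>lborel)"

definition T_hat_adj ::
  "(real^'p \<Rightarrow> real) \<Rightarrow>
   nat \<Rightarrow> real \<Rightarrow> real \<Rightarrow> (real^'p \<Rightarrow> real) \<Rightarrow> (real^'q \<Rightarrow> real) \<Rightarrow>
   (nat \<Rightarrow> real^'p) \<Rightarrow> (nat \<Rightarrow> real^'q) \<Rightarrow> (real^'q \<Rightarrow> complex) \<Rightarrow> real^'p \<Rightarrow> complex" where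
  "T_hat_adj \<pi> n h hW K KW z w \<psi> v =
     (\<integral>u. \<psi> u * complex_of_real (f_hat n h hW K KW z w u v * (1 / \<pi> v)) \<partial>lborel)"

section \<open>Landweber--Fridman regularization\<close>

text \<open>\<open>landweber a m A A' s\<close> is \<open>a (\<Sum>l=0..m. (I - a A' A)^l A' s)\<close>.\<close>

definition landweber ::
  "real \<Rightarrow> nat \<Rightarrow> (('a \<Rightarrow> complex) \<Rightarrow> 'b \<Rightarrow> complex) \<Rightarrow> (('b \<Rightarrow> complex) \<Rightarrow> 'a \<Rightarrow> complex) \<Rightarrow>
   ('b \<Rightarrow> complex) \<Rightarrow> 'a \<Rightarrow> complex" where
  "landweber a m A A' s v = complex_of_real a *
     (\<Sum>l=0..m. ((\<lambda>\<phi> x. \<phi> x - complex_of_real a * A' (A \<phi>) x) ^^ l) (A' s) v)"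

end

theory Submission
  imports Defs
begin

text \<open>
  On trigonometric sums and on sums of shifted kernels, both adjoint operators reduce to double sums
  over the sample, whose coefficients are \<open>\<F>\<^sub>\<mu>(W\<^sub>i - W\<^sub>j)\<close> and \<open>\<integral> k(u - W\<^sub>i) k(u - W\<^sub>j) du\<close>
  respectively, where \<open>k = K\<^sub>W(\<cdot> / h\<^sub>W) / h\<^sub>W\<^sup>q\<close>. As \<open>\<F>\<^sub>\<mu> = k \<star> k\<close>, these agree when \<open>k\<close> is even and
  square integrable. Neither is assumed. Evenness almost everywhere follows because \<open>k \<star> k\<close> is even
  and positive definite, and square integrability because \<open>(k \<star> k)(0) = \<mu>(\<T>) \<noteq> 0\<close>.
\<close>

section \<open>Convolution of integrable functions\<close>

text \<open>The smoothed operators see correlations \<open>k(u - x) k(u - y)\<close>, while the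
  hypothesis fixes a convolution \<open>k(u) k(x - u)\<close>. The two differ by the reflection of
  one factor, which is why evenness must be recovered. Heuristically, the squared Fourier transform
  of \<open>k\<close> is, up to a constant, a density of \<open>\<mu>\<close>; a complex number with
  a nonnegative square is real, and a real transform belongs to an even function. The obstacle is
  that \<open>k\<close> is only known to be integrable: its square might not be, and a convolution
  integral may diverge on a null set, where \<open>convolve\<close> returns 0. So the algebra of
  convolutions holds almost everywhere, functions are mollified before they are squared, and
  continuity has to restore a value at a given point. The final comparison is pointwise in
  \<open>v\<close>: where \<open>\<pi> v = 0\<close>, division yields 0 on both sides.\<close>

lemma lborel_integrable_affine:
  fixes f :: "'a::euclidean_space \<Rightarrow> 'b::{banach, second_countable_topology}"
  assumes f: "integrable lborel f" and c: "c \<noteq> 0"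
  shows "integrable lborel (\<lambda>x. f (t + c *\<^sub>R x))"
proof -
  have [measurable]: "f \<in> borel_measurable borel"
    using f by auto
  have "integrable (density (distr lborel borel (\<lambda>x. t + c *\<^sub>R x)) (\<lambda>_. ennreal (\<bar>c\<bar> ^ DIM('a)))) f"
    using f lborel_affine[OF c, of t] by simp
  then have "integrable (distr lborel borel (\<lambda>x. t + c *\<^sub>R x)) (\<lambda>x. \<bar>c\<bar> ^ DIM('a) *\<^sub>R f x)"
    by (subst (asm) integrable_density) auto
  then have "integrable lborel (\<lambda>x. \<bar>c\<bar> ^ DIM('a) *\<^sub>R f (t + c *\<^sub>R x))"
    by (subst (asm) integrable_distr_eq) auto
  from integrable_scaleR_right[OF this, of "inverse (\<bar>c\<bar> ^ DIM('a))"] show ?thesis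
    using c by simp
qed

lemma lborel_integral_affine:
  fixes f :: "'a::euclidean_space \<Rightarrow> 'b::{banach, second_countable_topology}"
  assumes [measurable]: "f \<in> borel_measurable borel" and c: "c \<noteq> 0"
  shows "(\<integral>x. f x \<partial>lborel) = \<bar>c\<bar> ^ DIM('a) *\<^sub>R (\<integral>x. f (t + c *\<^sub>R x) \<partial>lborel)"
proof -
  have "(\<integral>x. f x \<partial>lborel) =
      (\<integral>x. f x \<partial>density (distr lborel borel (\<lambda>x. t + c *\<^sub>R x)) (\<lambda>_. ennreal (\<bar>c\<bar> ^ DIM('a))))"
    using lborel_affine[OF c, of t] by simp
  also have "\<dots> = (\<integral>x. \<bar>c\<bar> ^ DIM('a) *\<^sub>R f x \<partial>distr lborel borel (\<lambda>x. t + c *\<^sub>R x))"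
    by (subst integral_density) auto
  also have "\<dots> = (\<integral>x. \<bar>c\<bar> ^ DIM('a) *\<^sub>R f (t + c *\<^sub>R x) \<partial>lborel)"
    by (subst integral_distr) auto
  finally show ?thesis
    by simp
qed

lemma AE_lborel_affine:
  fixes t :: "'a::euclidean_space"
  assumes P: "AE x in lborel. P x" and c: "c \<noteq> 0"
  shows "AE x in lborel. P (t + c *\<^sub>R x)"
proof -
  have "AE x in density (distr lborel borel (\<lambda>x. t + c *\<^sub>R x)) (\<lambda>_. ennreal (\<bar>c\<bar> ^ DIM('a))). P x"
    using P by (subst lborel_affine[OF c, of t, symmetric])
  then have "AE x in distr lborel borel (\<lambda>x. t + c *\<^sub>R x). P x"
    using c by (subst (asm) AE_density) (auto simp: ennreal_power[symmetric] ennreal_zero_less_mult_iff)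
  then show ?thesis
    by (rule AE_distrD[rotated]) auto
qed

lemma
  fixes f :: "'a::euclidean_space \<Rightarrow> real"
  assumes f: "integrable lborel f"
  shows lborel_integrable_shift: "integrable lborel (\<lambda>x. f (x - t))"
    and lborel_integrable_flip: "integrable lborel (\<lambda>x. f (t - x))"
    and lborel_integrable_reflect: "integrable lborel (\<lambda>x. f (- x))"
  using lborel_integrable_affine[OF f, of 1 "-t"] lborel_integrable_affine[OF f, of "-1" t]
    lborel_integrable_affine[OF f, of "-1" 0] by auto

lemma
  fixes f :: "'a::euclidean_space \<Rightarrow> real"
  assumes f: "f \<in> borel_measurable borel"
  shows lborel_integral_shift: "(\<integral>x. f (x - t) \<partial>lborel) = (\<integral>x. f x \<partial>lborel)"
    and lborel_integral_flip: "(\<integral>x. f (t - x) \<partial>lborel) = (\<integral>x. f x \<partial>lborel)"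
    and lborel_integral_reflect: "(\<integral>x. f (- x) \<partial>lborel) = (\<integral>x. f x \<partial>lborel)"
  using lborel_integral_affine[OF f, of 1 "-t"] lborel_integral_affine[OF f, of "-1" t]
    lborel_integral_affine[OF f, of "-1" 0] by auto

lemma borel_measurable_convolve[measurable (raw)]:
  assumes [measurable]: "f \<in> borel_measurable borel" "g \<in> borel_measurable borel"
  shows "convolve f g \<in> borel_measurable borel"
  unfolding convolve_def by measurable

lemma integrable_convolve_pair:
  fixes f g :: "'a::euclidean_space \<Rightarrow> real"
  assumes f: "integrable lborel f" and g: "integrable lborel g"
  shows "integrable (lborel \<Otimes>\<^sub>M lborel) (\<lambda>(u, x). f u * g (x - u))"
proof (rule lborel_pair.Fubini_integrable)
  have [measurable]: "f \<in> borel_measurable borel" "g \<in> borel_measurable borel"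
    using f g by auto
  show "(\<lambda>(u, x). f u * g (x - u)) \<in> borel_measurable (lborel \<Otimes>\<^sub>M lborel)"
    by measurable
  have "(\<integral>x. norm (f u * g (x - u)) \<partial>lborel) = \<bar>f u\<bar> * (\<integral>x. \<bar>g x\<bar> \<partial>lborel)" for u
    using lborel_integral_shift[of "\<lambda>x. \<bar>g x\<bar>" u] by (simp add: abs_mult)
  then show "integrable lborel (\<lambda>u. \<integral>x. norm (case (u, x) of (u, x) \<Rightarrow> f u * g (x - u)) \<partial>lborel)"
    using f by simp
  show "AE u in lborel. integrable lborel (\<lambda>x. case (u, x) of (u, x) \<Rightarrow> f u * g (x - u))"
    using lborel_integrable_shift[OF g] by simp
qed

lemma
  fixes f g :: "'a::euclidean_space \<Rightarrow> real"
  assumes f: "integrable lborel f" and g: "integrable lborel g"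
  shows convolve_AE_integrable: "AE x in lborel. integrable lborel (\<lambda>u. f u * g (x - u))"
    and integrable_convolve: "integrable lborel (convolve f g)"
    and integral_convolve:
      "(\<integral>x. convolve f g x \<partial>lborel) = (\<integral>x. f x \<partial>lborel) * (\<integral>x. g x \<partial>lborel)"
proof -
  note pair = integrable_convolve_pair[OF f g]
  have [measurable]: "g \<in> borel_measurable borel"
    using g by auto
  show "AE x in lborel. integrable lborel (\<lambda>u. f u * g (x - u))"
    using lborel_pair.AE_integrable_snd[OF pair] by simp
  show "integrable lborel (convolve f g)"
    using lborel_pair.integrable_snd[OF pair] by (simp add: convolve_def[abs_def])
  have "(\<integral>x. convolve f g x \<partial>lborel) = (\<integral>u. \<integral>x. f u * g (x - u) \<partial>lborel \<partial>lborel)"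
    unfolding convolve_def using pair by (rule lborel_pair.Fubini_integral)
  also have "\<dots> = (\<integral>x. f x \<partial>lborel) * (\<integral>x. g x \<partial>lborel)"
    by (simp add: lborel_integral_shift)
  finally show "(\<integral>x. convolve f g x \<partial>lborel) = (\<integral>x. f x \<partial>lborel) * (\<integral>x. g x \<partial>lborel)" .
qed

lemma convolve_commute:
  fixes f g :: "'a::euclidean_space \<Rightarrow> real"
  assumes [measurable]: "f \<in> borel_measurable borel" "g \<in> borel_measurable borel"
  shows "convolve f g = convolve g f"
proof
  fix x
  show "convolve f g x = convolve g f x"
    unfolding convolve_def
    using lborel_integral_flip[of "\<lambda>u. f u * g (x - u)" x] by (simp add: mult.commute)
qed

lemma convolve_reflect:
  fixes f g :: "'a::euclidean_space \<Rightarrow> real"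
  assumes [measurable]: "f \<in> borel_measurable borel" "g \<in> borel_measurable borel"
  shows "convolve (\<lambda>x. f (- x)) (\<lambda>x. g (- x)) x = convolve f g (- x)"
  unfolding convolve_def
  using lborel_integral_reflect[of "\<lambda>u. f u * g (- x - u)"] by (simp add: minus_diff_commute add.commute)

text \<open>The conclusion holds at every point: an integral, including the default value of a
  divergent one, does not notice a null set.\<close>

lemma convolve_cong_AE:
  fixes f g :: "'a::euclidean_space \<Rightarrow> real"
  assumes [measurable]: "f \<in> borel_measurable borel" "g \<in> borel_measurable borel"
    "f' \<in> borel_measurable borel" "g' \<in> borel_measurable borel"
    and ff: "AE x in lborel. f x = f' x" and gg: "AE x in lborel. g x = g' x"
  shows "convolve f g = convolve f' g'"
proof
  fix x
  have "AE u in lborel. g (x - u) = g' (x - u)"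
    using AE_lborel_affine[OF gg, of "-1" x] by simp
  with ff have "AE u in lborel. f u * g (x - u) = f' u * g' (x - u)"
    by eventually_elim simp
  then show "convolve f g x = convolve f' g' x"
    unfolding convolve_def
    by (intro integral_cong_AE) simp_all
qed

text \<open>At an exceptional point an integral may diverge and be read as 0, so additivity is
  claimed only where both summands converge.\<close>

lemma convolve_add_right_AE:
  fixes f g :: "'a::euclidean_space \<Rightarrow> real"
  assumes f: "integrable lborel f" and g: "integrable lborel g" and h: "integrable lborel h"
  shows "AE x in lborel. convolve f (\<lambda>u. g u + h u) x = convolve f g x + convolve f h x"
  using convolve_AE_integrable[OF f g] convolve_AE_integrable[OF f h]
  by eventually_elim (simp add: convolve_def distrib_left)

text \<open>Associativity is an exchange of integrals. It is legitimate at each \<open>x\<close>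
  where the convolution of \<open>q\<close>, which is built from absolute values, with
  \<open>h\<close> converges absolutely, hence at almost every \<open>x\<close>.\<close>

lemma convolve_assoc_AE:
  fixes f g h :: "'a::euclidean_space \<Rightarrow> real"
  assumes f: "integrable lborel f" and g: "integrable lborel g" and h: "integrable lborel h"
  shows "AE x in lborel. convolve (convolve f g) h x = convolve f (convolve g h) x"
proof -
  have [measurable]: "f \<in> borel_measurable borel" "g \<in> borel_measurable borel"
    "h \<in> borel_measurable borel"
    using f g h by auto
  define q where "q = convolve (\<lambda>u. \<bar>f u\<bar>) (\<lambda>u. \<bar>g u\<bar>)"
  have q: "integrable lborel q"
    unfolding q_def using f g by (intro integrable_convolve) auto
  have "AE x in lborel. integrable lborel (\<lambda>v. q v * h (x - v))"
    using q h by (rule convolve_AE_integrable)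
  then show ?thesis
  proof eventually_elim
    fix x assume x: "integrable lborel (\<lambda>v. q v * h (x - v))"
    have int: "integrable (lborel \<Otimes>\<^sub>M lborel) (\<lambda>(v, u). f u * g (v - u) * h (x - v))"
    proof (rule lborel_pair.Fubini_integrable)
      have "(\<integral>u. norm (f u * g (v - u) * h (x - v)) \<partial>lborel) = q v * \<bar>h (x - v)\<bar>" for v
        by (simp add: abs_mult q_def convolve_def)
      moreover have "integrable lborel (\<lambda>v. q v * \<bar>h (x - v)\<bar>)"
      proof -
        have "q v \<ge> 0" for v
          unfolding q_def convolve_def by (intro integral_nonneg_AE) auto
        then show ?thesis
          using integrable_norm[OF x] by (simp add: abs_mult)
      qed
      ultimately show "integrable lborel
          (\<lambda>v. \<integral>u. norm (case (v, u) of (v, u) \<Rightarrow> f u * g (v - u) * h (x - v)) \<partial>lborel)"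
        by simp
      show "AE v in lborel. integrable lborel
          (\<lambda>u. case (v, u) of (v, u) \<Rightarrow> f u * g (v - u) * h (x - v))"
        using convolve_AE_integrable[OF f g] by eventually_elim simp
    qed measurable
    have "convolve (convolve f g) h x = (\<integral>v. \<integral>u. f u * g (v - u) * h (x - v) \<partial>lborel \<partial>lborel)"
      by (simp add: convolve_def)
    also have "\<dots> = (\<integral>u. \<integral>v. f u * g (v - u) * h (x - v) \<partial>lborel \<partial>lborel)"
      using lborel_pair.Fubini_integral[OF int] by simp
    also have "\<dots> = (\<integral>u. f u * (\<integral>v. g (v - u) * h (x - u - (v - u)) \<partial>lborel) \<partial>lborel)"
      by (simp add: mult.assoc)
    also have "\<dots> = convolve f (convolve g h) x"
      unfolding convolve_def
      by (subst lborel_integral_shift[where f = "\<lambda>v. g v * h (x - u - v)" for u]) auto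
    finally show "convolve (convolve f g) h x = convolve f (convolve g h) x" .
  qed
qed

text \<open>The adjoint of convolution with \<open>g\<close> is convolution with the reflection of
  \<open>g\<close>, and oddness turns this into a minus sign. Boundedness of \<open>p\<close> makes
  the double integral absolutely convergent.\<close>

lemma integral_convolve_odd:
  fixes p f g :: "'a::euclidean_space \<Rightarrow> real"
  assumes p [measurable]: "p \<in> borel_measurable borel" and C: "\<And>x. \<bar>p x\<bar> \<le> C"
    and f: "integrable lborel f" and g: "integrable lborel g" and odd: "\<And>x. g (- x) = - g x"
  shows "(\<integral>x. p x * convolve f g x \<partial>lborel) = - (\<integral>u. f u * convolve p g u \<partial>lborel)"
proof -
  have [measurable]: "f \<in> borel_measurable borel" "g \<in> borel_measurable borel"
    using f g by auto
  have C0: "0 \<le> C"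
    using C[of 0] by linarith
  have int: "integrable (lborel \<Otimes>\<^sub>M lborel) (\<lambda>(u, x). p x * (f u * g (x - u)))"
    by (rule Bochner_Integration.integrable_bound
          [OF integrable_mult_right[OF integrable_convolve_pair[OF f g], of C]])
       (use C C0 in \<open>auto simp: split_beta abs_mult intro!: AE_I2 mult_right_mono\<close>)
  have "(\<integral>x. p x * convolve f g x \<partial>lborel) = (\<integral>x. \<integral>u. p x * (f u * g (x - u)) \<partial>lborel \<partial>lborel)"
    by (simp add: convolve_def)
  also have "\<dots> = (\<integral>u. \<integral>x. p x * (f u * g (x - u)) \<partial>lborel \<partial>lborel)"
    using int by (rule lborel_pair.Fubini_integral)
  also have "\<dots> = (\<integral>u. - (f u * convolve p g u) \<partial>lborel)"
  proof (rule Bochner_Integration.integral_cong)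
    fix u
    have "p x * (f u * g (x - u)) = - (f u * (p x * g (u - x)))" for x
      using odd[of "u - x"] by simp
    then show "(\<integral>x. p x * (f u * g (x - u)) \<partial>lborel) = - (f u * convolve p g u)"
      by (simp add: convolve_def)
  qed simp
  finally show ?thesis
    by simp
qed

text \<open>An endpoint case of Young's inequality. It bounds the mollified functions, so that their
  squares become integrable.\<close>

lemma convolve_bounded:
  fixes p f :: "'a::euclidean_space \<Rightarrow> real"
  assumes [measurable]: "p \<in> borel_measurable borel" and C: "\<And>x. \<bar>p x\<bar> \<le> C"
    and f: "integrable lborel f"
  shows "\<bar>convolve p f x\<bar> \<le> C * (\<integral>u. \<bar>f u\<bar> \<partial>lborel)"
proof -
  have [measurable]: "f \<in> borel_measurable borel"
    using f by auto
  have C0: "0 \<le> C"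
    using C[of 0] by linarith
  have "\<bar>convolve p f x\<bar> \<le> (\<integral>u. \<bar>p u * f (x - u)\<bar> \<partial>lborel)"
    unfolding convolve_def by (rule integral_abs_bound)
  also have "\<dots> \<le> (\<integral>u. C * \<bar>f (x - u)\<bar> \<partial>lborel)"
    using C C0 lborel_integrable_flip[OF integrable_abs[OF f]]
    by (intro integral_mono_AE') (auto simp: abs_mult intro!: mult_right_mono)
  also have "\<dots> = C * (\<integral>u. \<bar>f u\<bar> \<partial>lborel)"
    using lborel_integral_flip[of "\<lambda>u. \<bar>f u\<bar>" x] by simp
  finally show ?thesis .
qed

section \<open>Positive definiteness of characteristic functions\<close>

lemma Fubini_bounded_kernel:
  fixes p :: "'a::euclidean_space \<Rightarrow> real"
  assumes "finite_measure \<mu>" and p: "integrable lborel p"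
    and [measurable]: "(\<lambda>(u, t). g u t) \<in> borel_measurable (lborel \<Otimes>\<^sub>M \<mu>)"
    and C: "\<And>u t. \<bar>g u t\<bar> \<le> C"
  shows "(\<integral>u. p u * (\<integral>t. g u t \<partial>\<mu>) \<partial>lborel) = (\<integral>t. (\<integral>u. p u * g u t \<partial>lborel) \<partial>\<mu>)"
proof -
  interpret finite_measure \<mu> by fact
  interpret P: pair_sigma_finite lborel \<mu> ..
  have [measurable]: "p \<in> borel_measurable lborel"
    using p by auto
  have C0: "0 \<le> C"
    using C[of undefined undefined] by linarith
  have bnd: "integrable \<mu> (\<lambda>t. g u t)" for u
    by (rule integrable_const_bound[where B = C]) (use C in auto)
  have int: "integrable (lborel \<Otimes>\<^sub>M \<mu>) (\<lambda>(u, t). p u * g u t)"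
  proof (rule P.Fubini_integrable)
    show "AE u in lborel. integrable \<mu> (\<lambda>t. case (u, t) of (u, t) \<Rightarrow> p u * g u t)"
      using bnd by simp
    have "(\<integral>t. \<bar>g u t\<bar> \<partial>\<mu>) \<le> C * measure \<mu> (space \<mu>)" for u
      using integral_mono[OF integrable_abs[OF bnd], of "\<lambda>_. C" u] C by (simp add: mult.commute)
    then show "integrable lborel (\<lambda>u. \<integral>t. norm (case (u, t) of (u, t) \<Rightarrow> p u * g u t) \<partial>\<mu>)"
      by (intro Bochner_Integration.integrable_bound[OF integrable_mult_left[OF p, of "C * measure \<mu> (space \<mu>)"]])
         (use C0 in \<open>auto simp: abs_mult intro!: mult_left_mono\<close>)
  qed measurable
  show ?thesis
    using P.Fubini_integral[OF int] by simp
qed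

text \<open>The easy half of Bochner's theorem in real form: the quadratic form of \<open>F\<close>
  at \<open>p\<close> is the \<open>\<mu>\<close>-integral of the squared modulus of the Fourier
  transform of \<open>p\<close>. Its cosine and sine parts are \<open>c\<close> and
  \<open>s\<close>, and the addition formula for \<open>cos\<close> separates the variables.\<close>

lemma integral_convolve_char_nonneg:
  fixes p :: "'a::euclidean_space \<Rightarrow> real"
  assumes "finite_measure \<mu>" and id: "(\<lambda>t. t) \<in> borel_measurable \<mu>"
    and p: "integrable lborel p"
    and F: "\<And>v. F v = (\<integral>t. cos (v \<bullet> t) \<partial>\<mu>)"
  shows "0 \<le> (\<integral>x. p x * convolve p F x \<partial>lborel)"
proof -
  interpret finite_measure \<mu> by fact
  interpret P: pair_sigma_finite lborel \<mu> ..
  note [measurable] = id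
  have [measurable]: "p \<in> borel_measurable borel"
    using p by auto
  define c where "c t = (\<integral>u. p u * cos (u \<bullet> t) \<partial>lborel)" for t
  define s where "s t = (\<integral>u. p u * sin (u \<bullet> t) \<partial>lborel)" for t
  define N where "N = (\<integral>u. \<bar>p u\<bar> \<partial>lborel)"
  have [measurable]: "c \<in> borel_measurable \<mu>" "s \<in> borel_measurable \<mu>"
    unfolding c_def s_def by measurable
  have int: "integrable lborel (\<lambda>u. p u * cos (u \<bullet> t))" "integrable lborel (\<lambda>u. p u * sin (u \<bullet> t))" for t
    by (rule Bochner_Integration.integrable_bound[OF p];
        auto simp: abs_mult mult_left_le)+
  have c_le: "\<bar>c t\<bar> \<le> N" and s_le: "\<bar>s t\<bar> \<le> N" for t
    unfolding c_def s_def N_def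
    by (rule order.trans[OF integral_abs_bound];
        intro integral_mono_AE' integrable_abs p; auto simp: abs_mult mult_left_le)+
  have inner: "convolve p F x = (\<integral>t. cos (x \<bullet> t) * c t + sin (x \<bullet> t) * s t \<partial>\<mu>)" for x
  proof -
    have "convolve p F x = (\<integral>u. p u * (\<integral>t. cos ((x - u) \<bullet> t) \<partial>\<mu>) \<partial>lborel)"
      by (simp add: convolve_def F)
    also have "\<dots> = (\<integral>t. \<integral>u. p u * cos ((x - u) \<bullet> t) \<partial>lborel \<partial>\<mu>)"
      by (rule Fubini_bounded_kernel[where C = 1]) (use p in \<open>auto intro: finite_measure_axioms\<close>)
    also have "\<dots> = (\<integral>t. cos (x \<bullet> t) * c t + sin (x \<bullet> t) * s t \<partial>\<mu>)"
    proof (rule Bochner_Integration.integral_cong)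
      fix t
      have "(\<integral>u. p u * cos ((x - u) \<bullet> t) \<partial>lborel) =
          (\<integral>u. cos (x \<bullet> t) * (p u * cos (u \<bullet> t)) + sin (x \<bullet> t) * (p u * sin (u \<bullet> t)) \<partial>lborel)"
        by (simp add: inner_diff_left cos_diff algebra_simps)
      then show "(\<integral>u. p u * cos ((x - u) \<bullet> t) \<partial>lborel) = cos (x \<bullet> t) * c t + sin (x \<bullet> t) * s t"
        using int by (simp add: c_def s_def)
    qed simp
    finally show ?thesis .
  qed
  have le: "\<bar>cos (x \<bullet> t) * c t + sin (x \<bullet> t) * s t\<bar> \<le> N + N" for x t
  proof -
    have "\<bar>cos (x \<bullet> t) * c t\<bar> \<le> 1 * N" "\<bar>sin (x \<bullet> t) * s t\<bar> \<le> 1 * N"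
      unfolding abs_mult by (rule mult_mono; use c_le s_le in auto)+
    then show ?thesis by linarith
  qed
  have "(\<integral>x. p x * convolve p F x \<partial>lborel) =
      (\<integral>t. \<integral>x. p x * (cos (x \<bullet> t) * c t + sin (x \<bullet> t) * s t) \<partial>lborel \<partial>\<mu>)"
    unfolding inner
    by (rule Fubini_bounded_kernel[where C = "N + N"]) (use p le in \<open>auto intro: finite_measure_axioms\<close>)
  also have "\<dots> = (\<integral>t. (c t)\<^sup>2 + (s t)\<^sup>2 \<partial>\<mu>)"
  proof (rule Bochner_Integration.integral_cong)
    fix t
    have "(\<integral>x. p x * (cos (x \<bullet> t) * c t + sin (x \<bullet> t) * s t) \<partial>lborel) =
        (\<integral>x. p x * cos (x \<bullet> t) * c t + p x * sin (x \<bullet> t) * s t \<partial>lborel)"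
      by (simp add: algebra_simps)
    also have "\<dots> = c t * c t + s t * s t"
      using int by (simp add: c_def s_def)
    finally show "(\<integral>x. p x * (cos (x \<bullet> t) * c t + sin (x \<bullet> t) * s t) \<partial>lborel) = (c t)\<^sup>2 + (s t)\<^sup>2"
      by (simp add: power2_eq_square)
  qed simp
  also have "\<dots> \<ge> 0"
    by (intro integral_nonneg_AE) auto
  finally show ?thesis .
qed

section \<open>Evenness from a positive definite convolution square\<close>

lemma AE_zero_if_box_integrals_zero:
  fixes f :: "'a::euclidean_space \<Rightarrow> real"
  assumes f: "integrable lborel f"
    and box: "\<And>l u. (\<integral>x\<in>box l u. f x \<partial>lborel) = 0"
  shows "AE x in lborel. f x = 0"
proof -
  have set_int: "set_integrable lborel A f" if "A \<in> sets borel" for A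
    using f that unfolding set_integrable_def by (intro integrable_mult_indicator) auto
  \<comment> \<open>The complement step of the Dynkin argument needs the integral over the whole
    space, which is not a box but an increasing union of boxes.\<close>
  have univ: "(\<integral>x\<in>UNIV. f x \<partial>lborel) = 0"
  proof (rule LIMSEQ_unique)
    let ?B = "\<lambda>n::nat. box (- (real n *\<^sub>R One)) (real n *\<^sub>R One) :: 'a set"
    have "(\<lambda>n. \<integral>x\<in>?B n. f x \<partial>lborel) \<longlonglongrightarrow> (\<integral>x\<in>(\<Union>n. ?B n). f x \<partial>lborel)"
    proof (rule set_integral_cont_up)
      show "incseq ?B"
        by (auto simp: incseq_def box_def)
    qed (use set_int UN_box_eq_UNIV in auto)
    then show "(\<lambda>n. \<integral>x\<in>?B n. f x \<partial>lborel) \<longlonglongrightarrow> (\<integral>x\<in>UNIV. f x \<partial>lborel)"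
      by (simp only: UN_box_eq_UNIV)
    show "(\<lambda>n. \<integral>x\<in>?B n. f x \<partial>lborel) \<longlonglongrightarrow> 0"
      by (simp add: box)
  qed
  let ?E = "range (\<lambda>(a, b). box a b :: 'a set)"
  \<comment> \<open>Boxes are stable under intersection and generate the Borel sets, and the sets
    with zero integral are closed under complements and countable disjoint unions.\<close>
  have zero: "(\<integral>x\<in>A. f x \<partial>lborel) = 0" if "A \<in> sigma_sets UNIV ?E" for A
  proof -
    have "Int_stable ?E"
      by (auto simp: Int_stable_def box_Int_box)
    moreover have "?E \<subseteq> Pow UNIV"
      by simp
    ultimately show ?thesis
      using that
    proof (induction rule: sigma_sets_induct_disjoint)
      case (basic A)
      then show ?case
        using box by auto
    next
      case empty
      show ?case
        by (simp add: set_lebesgue_integral_def)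
    next
      case (compl A)
      then have A: "A \<in> sets borel"
        by (simp add: borel_eq_box)
      have "(\<integral>x\<in>A \<union> (UNIV - A). f x \<partial>lborel) =
          (\<integral>x\<in>A. f x \<partial>lborel) + (\<integral>x\<in>UNIV - A. f x \<partial>lborel)"
        using A by (intro set_integral_Un set_int) auto
      then show ?case
        using compl univ by simp
    next
      case (union A)
      then have A: "A i \<in> sets borel" for i
        by (auto simp: borel_eq_box)
      have "(\<integral>x\<in>(\<Union>i. A i). f x \<partial>lborel) = (\<Sum>i. \<integral>x\<in>A i. f x \<partial>lborel)"
        by (rule lebesgue_integral_countable_add)
           (use A union in \<open>auto simp: disjoint_family_on_def intro!: set_int\<close>)
      then show ?case
        using union by simp
    qed
  qed
  show ?thesis
    by (rule density_unique_real) (use f zero in \<open>auto simp: borel_eq_box\<close>)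
qed

lemma AE_zero_if_continuous_tests_zero:
  fixes f :: "'a::euclidean_space \<Rightarrow> real"
  assumes f: "integrable lborel f"
    and test: "\<And>\<phi>. continuous_on UNIV \<phi> \<Longrightarrow> (\<And>x. \<bar>\<phi> x\<bar> \<le> 1) \<Longrightarrow> integrable lborel \<phi> \<Longrightarrow>
      (\<integral>x. f x * \<phi> x \<partial>lborel) = 0"
  shows "AE x in lborel. f x = 0"
  using f
proof (rule AE_zero_if_box_integrals_zero)
  fix l u :: 'a
  have [measurable]: "f \<in> borel_measurable borel"
    using f by auto
  \<comment> \<open>The distance to an empty set is 0 by convention, so the ramp below needs a
    nonempty complement.\<close>
  have ne: "- box l u \<noteq> {}"
    using bounded_box[of l u] not_bounded_UNIV by (metis Compl_empty_eq double_compl)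
  \<comment> \<open>A continuous ramp: 0 off the box, and 1 at distance at least \<open>1/n\<close>
    from its complement, so it tends pointwise to the indicator of the box.\<close>
  define \<phi> where "\<phi> n x = min 1 (real n * infdist x (- box l u))" for n x
  have cont: "continuous_on UNIV (\<phi> n)" for n
    unfolding \<phi>_def by (intro continuous_intros)
  then have [measurable]: "\<phi> n \<in> borel_measurable borel" for n
    by (rule borel_measurable_continuous_onI)
  have \<phi>01: "0 \<le> \<phi> n x" "\<phi> n x \<le> 1" for n x
    unfolding \<phi>_def by (auto simp: infdist_nonneg)
  have out: "\<phi> n x = 0" if "x \<notin> box l u" for n x
    using that unfolding \<phi>_def by simp
  have "integrable lborel (\<phi> n)" for n
    by (rule Bochner_Integration.integrable_bound[where f = "indicator (box l u) :: 'a \<Rightarrow> real"])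
       (use \<phi>01 out in \<open>auto simp: indicator_def emeasure_lborel_box_eq\<close>)
  then have zero: "(\<integral>x. f x * \<phi> n x \<partial>lborel) = 0" for n
    using \<phi>01 by (intro test cont) auto
  have lim: "(\<lambda>n. \<phi> n x) \<longlonglongrightarrow> indicator (box l u) x" for x
  proof (cases "x \<in> box l u")
    case True
    have d: "infdist x (- box l u) > 0"
    proof -
      have "closed (- box l u)"
        by (simp add: open_box closed_Compl)
      then have "infdist x (- box l u) \<noteq> 0"
        using True ne by (metis ComplD in_closed_iff_infdist_zero)
      then show ?thesis
        using infdist_nonneg[of x "- box l u"] by linarith
    qed
    then obtain N where N: "1 < real N * infdist x (- box l u)"
      using reals_Archimedean3 by blast
    have "\<phi> n x = 1" if "n \<ge> N" for n
    proof -
      have "real N * infdist x (- box l u) \<le> real n * infdist x (- box l u)"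
        using d that by (intro mult_right_mono) auto
      then show ?thesis
        using N unfolding \<phi>_def by simp
    qed
    then have "eventually (\<lambda>n. \<phi> n x = 1) sequentially"
      by (auto simp: eventually_sequentially)
    then show ?thesis
      using True by (simp add: tendsto_eventually)
  next
    case False
    then show ?thesis
      by (simp add: out)
  qed
  have "(\<lambda>n. \<integral>x. f x * \<phi> n x \<partial>lborel) \<longlonglongrightarrow> (\<integral>x. f x * indicator (box l u) x \<partial>lborel)"
  proof (rule integral_dominated_convergence[where w = "\<lambda>x. \<bar>f x\<bar>"])
    show "AE x in lborel. (\<lambda>n. f x * \<phi> n x) \<longlonglongrightarrow> f x * indicator (box l u) x"
      using lim by (intro AE_I2 tendsto_mult tendsto_const)
    show "AE x in lborel. norm (f x * \<phi> n x) \<le> \<bar>f x\<bar>" for n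
      using \<phi>01 by (intro AE_I2) (auto simp: abs_mult intro!: mult_left_le)
  qed (use f in auto)
  then show "(\<integral>x\<in>box l u. f x \<partial>lborel) = 0"
    unfolding zero set_lebesgue_integral_def
    by (simp add: LIMSEQ_const_iff mult.commute)
qed

text \<open>Boundedness makes the square integrable, so a zero integral is genuine rather than the
  default value of a divergent one.\<close>

lemma AE_zero_if_integral_square_zero:
  fixes f :: "'a::euclidean_space \<Rightarrow> real"
  assumes f: "integrable lborel f" and C: "\<And>x. \<bar>f x\<bar> \<le> C"
    and sq: "(\<integral>x. f x * f x \<partial>lborel) \<le> 0"
  shows "AE x in lborel. f x = 0"
proof -
  have [measurable]: "f \<in> borel_measurable borel"
    using f by auto
  have "norm (f x * f x) \<le> norm (f x * C)" for x
    using C[of x] unfolding real_norm_def abs_mult by (intro mult_left_mono) auto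
  then have "integrable lborel (\<lambda>x. f x * f x)"
    by (intro Bochner_Integration.integrable_bound[OF integrable_mult_left[OF f, of C]]) auto
  moreover have "(\<integral>x. f x * f x \<partial>lborel) = 0"
    using sq by (intro antisym integral_nonneg_AE) auto
  ultimately show ?thesis
    by (subst (asm) integral_nonneg_eq_0_iff_AE) auto
qed

lemma continuous_on_convolve:
  fixes f \<phi> :: "'a::euclidean_space \<Rightarrow> real"
  assumes f: "integrable lborel f" and \<phi>: "continuous_on UNIV \<phi>" and C: "\<And>x. \<bar>\<phi> x\<bar> \<le> C"
  shows "continuous_on UNIV (convolve f \<phi>)"
proof -
  have [measurable]: "f \<in> borel_measurable borel" "\<phi> \<in> borel_measurable borel"
    using f \<phi> by (auto intro: borel_measurable_continuous_onI)
  have "isCont (convolve f \<phi>) x" for x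
    unfolding continuous_at_sequentially
  proof (intro allI impI)
    fix X assume X: "X \<longlonglongrightarrow> x"
    have "isCont \<phi> z" for z
      using \<phi> by (simp add: continuous_on_eq_continuous_at)
    then have lim: "(\<lambda>n. \<phi> (X n - u)) \<longlonglongrightarrow> \<phi> (x - u)" for u
      by (rule isCont_tendsto_compose) (intro tendsto_diff X tendsto_const)
    have "(\<lambda>n. \<integral>u. f u * \<phi> (X n - u) \<partial>lborel) \<longlonglongrightarrow> (\<integral>u. f u * \<phi> (x - u) \<partial>lborel)"
    proof (rule integral_dominated_convergence[where w = "\<lambda>u. \<bar>f u\<bar> * C"])
      show "AE u in lborel. (\<lambda>n. f u * \<phi> (X n - u)) \<longlonglongrightarrow> f u * \<phi> (x - u)"
        using lim by (intro AE_I2 tendsto_mult tendsto_const)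
      show "AE u in lborel. norm (f u * \<phi> (X n - u)) \<le> \<bar>f u\<bar> * C" for n
        using C by (intro AE_I2) (auto simp: abs_mult intro!: mult_left_mono)
    qed (use f in auto)
    then show "(convolve f \<phi> \<circ> X) \<longlonglongrightarrow> convolve f \<phi> x"
      by (simp add: o_def convolve_def)
  qed
  then show ?thesis
    by (simp add: continuous_on_eq_continuous_at)
qed

text \<open>The set where \<open>f\<close> is nonzero is open, and a nonempty open set is not
  null.\<close>

lemma AE_zero_imp_zero_if_continuous:
  fixes f :: "'a::euclidean_space \<Rightarrow> real"
  assumes "continuous_on UNIV f" and "AE x in lborel. f x = 0"
  shows "f x = 0"
proof (rule ccontr)
  assume "f x \<noteq> 0"
  let ?S = "{x. f x \<noteq> 0}"
  have S: "open ?S"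
    using assms(1) by (intro open_Collect_neq) auto
  have [measurable]: "f \<in> borel_measurable borel"
    using assms(1) by (rule borel_measurable_continuous_onI)
  have "emeasure lborel ?S = 0"
    using assms(2) by (subst AE_iff_measurable[symmetric, where P = "\<lambda>x. f x = 0"]) auto
  then have "?S \<in> null_sets lborel"
    by (simp add: null_sets_def)
  then have "negligible ?S"
    by (simp add: null_sets_completion_iff negligible_iff_null_sets completion.complete2 null_sets_completionI)
  then show False
    using open_not_negligible[OF S] \<open>f x \<noteq> 0\<close> by blast
qed

text \<open>
  In terms of Fourier transforms, the transform of an even real function is real and that of an odd
  one is imaginary. Evenness of the convolution square makes the product of the two transforms
  vanish, and positivity says that the sum of their squares is nonnegative, so the transform of the
  odd part is zero. The proof replays this with a mollified odd part \<open>p\<close>.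
\<close>

lemma AE_even_if_convolve_self_even_positive:
  fixes k :: "'a::euclidean_space \<Rightarrow> real"
  assumes k: "integrable lborel k"
    and even: "\<And>x. convolve k k (- x) = convolve k k x"
    and pos: "\<And>p. integrable lborel p \<Longrightarrow>
      0 \<le> (\<integral>x. p x * convolve p (convolve k k) x \<partial>lborel)"
  shows "AE x in lborel. k (- x) = k x"
proof -
  have [measurable]: "k \<in> borel_measurable borel"
    using k by auto
  define q where "q x = (k x - k (- x)) / 2" for x
  define e where "e x = (k x + k (- x)) / 2" for x
  have k_eq: "k = (\<lambda>x. e x + q x)"
    by (auto simp: e_def q_def field_simps)
  have q: "integrable lborel q" and e: "integrable lborel e"
    unfolding q_def e_def using k lborel_integrable_reflect[OF k] by auto
  have q_odd: "q (- x) = - q x" for x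
    by (simp add: q_def field_simps)
  have [measurable]: "q \<in> borel_measurable borel" "e \<in> borel_measurable borel"
    using q e by auto
  \<comment> \<open>With \<open>?r\<close> the reflection of \<open>k\<close>, four times this
    convolution expands to that of \<open>k - ?r\<close> with \<open>k + ?r\<close>. The mixed terms
    cancel by commutativity and the pure ones because \<open>convolve k k\<close> is even.\<close>
  have qe: "AE x in lborel. convolve q e x = 0"
  proof -
    let ?r = "\<lambda>x. k (- x)"
    have r: "integrable lborel ?r"
      using k by (rule lborel_integrable_reflect)
    note ints = convolve_AE_integrable[OF k k] convolve_AE_integrable[OF k r]
      convolve_AE_integrable[OF r k] convolve_AE_integrable[OF r r]
    show ?thesis
      using ints
    proof eventually_elim
      case (elim x)
      have "convolve q e x =
          (\<integral>u. (k u * k (x - u) + k u * ?r (x - u) - ?r u * k (x - u) - ?r u * ?r (x - u)) / 4 \<partial>lborel)"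
        unfolding convolve_def q_def e_def by (intro Bochner_Integration.integral_cong) (auto simp: field_simps)
      also have "\<dots> = (convolve k k x + convolve k ?r x - convolve ?r k x - convolve ?r ?r x) / 4"
        using elim by (simp add: convolve_def)
      also have "convolve k ?r x = convolve ?r k x"
        by (subst convolve_commute) auto
      also have "convolve ?r ?r x = convolve k k x"
        using convolve_reflect[of k k x] even by simp
      finally show ?case
        by simp
    qed
  qed
  have qk: "AE x in lborel. convolve q k x = convolve q q x"
    using convolve_add_right_AE[OF q e q] qe unfolding k_eq[symmetric] by eventually_elim simp
  have "AE x in lborel. q x = 0"
    using q
  proof (rule AE_zero_if_continuous_tests_zero)
    fix \<phi> :: "'a \<Rightarrow> real"
    assume \<phi>_cont: "continuous_on UNIV \<phi>" and \<phi>1: "\<And>x. \<bar>\<phi> x\<bar> \<le> 1" and \<phi>: "integrable lborel \<phi>"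
    \<comment> \<open>Reflecting the test function makes its pairing with \<open>q\<close> the value
      at the origin of \<open>convolve q \<psi>\<close>, which is \<open>p\<close>.\<close>
    define \<psi> where "\<psi> x = \<phi> (- x)" for x
    have \<psi>: "integrable lborel \<psi>"
      unfolding \<psi>_def using \<phi> by (rule lborel_integrable_reflect)
    have \<psi>_cont: "continuous_on UNIV \<psi>"
      unfolding \<psi>_def by (intro continuous_on_compose2[OF \<phi>_cont] continuous_intros) auto
    have \<psi>1: "\<bar>\<psi> x\<bar> \<le> 1" for x
      by (simp add: \<psi>_def \<phi>1)
    have [measurable]: "\<psi> \<in> borel_measurable borel"
      using \<psi> by auto
    \<comment> \<open>\<open>q\<close> itself may be neither bounded nor square integrable;
      \<open>p\<close> and, later, \<open>r\<close> are bounded and integrable.\<close>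
    define p where "p = convolve \<psi> q"
    define N where "N = (\<integral>u. \<bar>q u\<bar> \<partial>lborel)"
    have p: "integrable lborel p"
      unfolding p_def using \<psi> q by (rule integrable_convolve)
    then have [measurable]: "p \<in> borel_measurable borel"
      by auto
    have p_le: "\<bar>p x\<bar> \<le> N" for x
      using convolve_bounded[OF _ \<psi>1 q] by (simp add: p_def N_def)
    define r where "r = convolve p q"
    have r: "integrable lborel r"
      unfolding r_def using p q by (rule integrable_convolve)
    then have [measurable]: "r \<in> borel_measurable borel"
      by auto
    have r_le: "\<bar>r x\<bar> \<le> N * N" for x
      using convolve_bounded[OF _ p_le q] by (simp add: r_def N_def)
    have pk: "AE x in lborel. convolve p k x = r x"
    proof -
      have "convolve \<psi> (convolve q k) = convolve \<psi> (convolve q q)"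
        using qk by (intro convolve_cong_AE) auto
      then show ?thesis
        using convolve_assoc_AE[OF \<psi> q k] convolve_assoc_AE[OF \<psi> q q]
        unfolding r_def p_def by (elim AE_mp, intro AE_I2) simp
    qed
    \<comment> \<open>Both factors \<open>k\<close> are traded for \<open>q\<close>: the first
      through \<open>pk\<close>, the second through \<open>qk\<close>, with associativity in
      between.\<close>
    have "AE x in lborel. convolve p (convolve k k) x = convolve r q x"
    proof -
      have 1: "convolve (convolve p k) k = convolve r k"
        using pk by (intro convolve_cong_AE) auto
      have 2: "convolve p (convolve q k) = convolve p (convolve q q)"
        using qk by (intro convolve_cong_AE) auto
      from convolve_assoc_AE[OF p k k] convolve_assoc_AE[OF p q k] convolve_assoc_AE[OF p q q]
      show ?thesis
        by eventually_elim (simp add: 1 2 r_def[symmetric])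
    qed
    \<comment> \<open>Oddness of \<open>q\<close> makes the nonnegative quadratic form equal to
      minus the integral of the square of \<open>r\<close>, so \<open>r\<close> vanishes. The same
      device, applied to \<open>p = convolve \<psi> q\<close>, then carries this over to
      \<open>p\<close>.\<close>
    then have "(\<integral>x. p x * convolve p (convolve k k) x \<partial>lborel) = (\<integral>x. p x * convolve r q x \<partial>lborel)"
      by (intro integral_cong_AE) auto
    also have "\<dots> = - (\<integral>x. r x * r x \<partial>lborel)"
      using integral_convolve_odd[OF _ p_le r q q_odd] by (simp add: r_def[symmetric])
    finally have "(\<integral>x. r x * r x \<partial>lborel) \<le> 0"
      using pos[OF p] by simp
    then have r0: "AE x in lborel. r x = 0"
      by (rule AE_zero_if_integral_square_zero[OF r r_le])
    have "(\<integral>x. p x * p x \<partial>lborel) = - (\<integral>u. \<psi> u * r u \<partial>lborel)"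
      using integral_convolve_odd[OF _ p_le \<psi> q q_odd] by (simp add: p_def[symmetric] r_def[symmetric])
    also have "(\<integral>u. \<psi> u * r u \<partial>lborel) = 0"
      using r0 by (intro integral_eq_zero_AE) auto
    finally have "(\<integral>x. p x * p x \<partial>lborel) \<le> 0"
      by simp
    then have p0: "AE x in lborel. p x = 0"
      by (rule AE_zero_if_integral_square_zero[OF p p_le])
    have p_eq: "p = convolve q \<psi>"
      unfolding p_def by (rule convolve_commute) auto
    have "p 0 = 0"
      by (rule AE_zero_imp_zero_if_continuous[OF _ p0])
         (unfold p_eq, rule continuous_on_convolve[OF q \<psi>_cont \<psi>1])
    then show "(\<integral>x. q x * \<phi> x \<partial>lborel) = 0"
      by (simp add: p_eq convolve_def \<psi>_def)
  qed
  then show ?thesis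
    by eventually_elim (simp add: q_def)
qed

text \<open>Evenness turns the correlation into \<open>convolve k k (y - x)\<close>, and the
  symmetry of the transform removes the remaining sign. Integrability is stated separately because
  the double sums are integrated term by term.\<close>

lemma
  fixes k :: "'a::euclidean_space \<Rightarrow> real"
  assumes k: "integrable lborel k" and k1: "(\<integral>x. k x \<partial>lborel) \<noteq> 0"
    and "finite_measure \<mu>" and id: "(\<lambda>t. t) \<in> borel_measurable \<mu>"
    and F: "\<And>v. complex_of_real (convolve k k v) = fourier \<mu> v"
    and sym: "\<And>v. fourier \<mu> v = fourier \<mu> (- v)"
  shows convolve_self_fourier_integrable: "integrable lborel (\<lambda>u. k (u - x) * k (u - y))"
    and convolve_self_fourier_integral:
      "complex_of_real (\<integral>u. k (u - x) * k (u - y) \<partial>lborel) = fourier \<mu> (x - y)"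
proof -
  interpret finite_measure \<mu> by fact
  note [measurable] = id
  have [measurable]: "k \<in> borel_measurable borel"
    using k by auto
  have int_iexp: "integrable \<mu> (\<lambda>t. iexp (v \<bullet> t))" for v
    by (rule integrable_const_bound[where B = 1]) (auto simp: norm_exp_i_times)
  have F_cos: "convolve k k v = (\<integral>t. cos (v \<bullet> t) \<partial>\<mu>)" for v
  proof -
    have "convolve k k v = Re (fourier \<mu> v)"
      unfolding F[symmetric] by simp
    also have "\<dots> = (\<integral>t. Re (iexp (v \<bullet> t)) \<partial>\<mu>)"
      unfolding fourier_def using int_iexp by (simp add: integral_Re)
    finally show ?thesis
      by (simp add: Re_exp)
  qed
  have k_even: "AE x in lborel. k (- x) = k x"
  proof (rule AE_even_if_convolve_self_even_positive[OF k])
    show "convolve k k (- x) = convolve k k x" for x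
      using F[of x] F[of "- x"] sym[of x] by (metis of_real_eq_iff)
    show "0 \<le> (\<integral>x. p x * convolve p (convolve k k) x \<partial>lborel)" if "integrable lborel p" for p
      using assms(3) id that F_cos by (rule integral_convolve_char_nonneg)
  qed
  have k_flip: "AE u in lborel. k (y - u) = k (u - y)" for y
    using AE_lborel_affine[OF k_even, of 1 "- y"] by simp
  \<comment> \<open>The value at the origin is the total mass of \<open>\<mu>\<close>. Were it 0,
    the transform and hence \<open>convolve k k\<close> would vanish everywhere, although the latter
    integrates to the square of the nonzero integral of \<open>k\<close>.\<close>
  have "convolve k k 0 \<noteq> 0"
  proof
    assume "convolve k k 0 = 0"
    then have "measure \<mu> (space \<mu>) = 0"
      using F_cos[of 0] by simp
    moreover have "\<bar>convolve k k v\<bar> \<le> measure \<mu> (space \<mu>)" for v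
    proof -
      have "\<bar>convolve k k v\<bar> \<le> (\<integral>t. \<bar>cos (v \<bullet> t)\<bar> \<partial>\<mu>)"
        unfolding F_cos by (rule integral_abs_bound)
      also have "\<dots> \<le> (\<integral>t. 1 \<partial>\<mu>)"
        by (intro integral_mono_AE') auto
      finally show ?thesis
        by simp
    qed
    ultimately have "convolve k k v = 0" for v
      by (metis abs_le_zero_iff)
    then show False
      using integral_convolve[OF k k] k1 by simp
  qed
  txt \<open>The integral defining the convolution at the origin cannot be the junk value 0 of a
    divergent integral, so \<open>k\<close> is square integrable.\<close>
  then have "integrable lborel (\<lambda>u. k u * k (0 - u))"
    unfolding convolve_def using not_integrable_integral_eq by blast
  then have "integrable lborel (\<lambda>u. k u * k u)"
    by (rule integrable_cong_AE_imp) (use k_even in auto)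
  then have sq: "integrable lborel (\<lambda>u. (k (u - x))\<^sup>2)" for x
    using lborel_integrable_shift[of "\<lambda>u. k u * k u" x] by (simp add: power2_eq_square)
  show "integrable lborel (\<lambda>u. k (u - x) * k (u - y))"
  proof (rule Bochner_Integration.integrable_bound[OF Bochner_Integration.integrable_add[OF sq[of x] sq[of y]]])
    show "AE u in lborel. norm (k (u - x) * k (u - y)) \<le> norm ((k (u - x))\<^sup>2 + (k (u - y))\<^sup>2)"
    proof (rule AE_I2)
      fix u
      have "2 * (\<bar>k (u - x)\<bar> * \<bar>k (u - y)\<bar>) \<le> (k (u - x))\<^sup>2 + (k (u - y))\<^sup>2"
        using sum_squares_bound[of "\<bar>k (u - x)\<bar>" "\<bar>k (u - y)\<bar>"] by simp
      moreover have "0 \<le> \<bar>k (u - x)\<bar> * \<bar>k (u - y)\<bar>"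
        by simp
      ultimately show "norm (k (u - x) * k (u - y)) \<le> norm ((k (u - x))\<^sup>2 + (k (u - y))\<^sup>2)"
        unfolding real_norm_def abs_mult by linarith
    qed
  qed simp
  have "(\<integral>u. k (u - x) * k (u - y) \<partial>lborel) = (\<integral>u. k (u - x) * k (y - u) \<partial>lborel)"
    using k_flip[of y] by (intro integral_cong_AE) auto
  also have "\<dots> = convolve k k (y - x)"
    unfolding convolve_def
    using lborel_integral_shift[of "\<lambda>u. k u * k (y - x - u)" x] by simp
  finally show "complex_of_real (\<integral>u. k (u - x) * k (u - y) \<partial>lborel) = fourier \<mu> (x - y)"
    using F[of "y - x"] sym[of "x - y"] by simp
qed

section \<open>The estimators as finite sums\<close>

definition rescaled :: "real \<Rightarrow> ('a::euclidean_space \<Rightarrow> real) \<Rightarrow> 'a \<Rightarrow> real" where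
  "rescaled h K u = K (u /\<^sub>R h) / h ^ DIM('a)"

text \<open>Of the two factors \<open>1 / h ^ DIM('a)\<close> in the convolution, the substitution
  absorbs one. This is the origin of the single factor in the hypothesis on the kernel.\<close>

lemma
  fixes K :: "'a::euclidean_space \<Rightarrow> real"
  assumes K: "integrable lborel K" and h: "h > 0"
  shows integrable_rescaled: "integrable lborel (rescaled h K)"
    and integral_rescaled: "(\<integral>u. rescaled h K u \<partial>lborel) = (\<integral>u. K u \<partial>lborel)"
    and convolve_rescaled: "convolve (rescaled h K) (rescaled h K) v =
      1 / h ^ DIM('a) * convolve K K (v /\<^sub>R h)"
proof -
  have [measurable]: "K \<in> borel_measurable borel"
    using K by auto
  show "integrable lborel (rescaled h K)"
    unfolding rescaled_def[abs_def] using lborel_integrable_affine[OF K, of "inverse h" 0] h by simp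
  show "(\<integral>u. rescaled h K u \<partial>lborel) = (\<integral>u. K u \<partial>lborel)"
    unfolding rescaled_def using lborel_integral_affine[of K "inverse h" 0] h
    by (simp add: field_simps)
  let ?D = "h ^ DIM('a)"
  have "(\<integral>u. K u * K (v /\<^sub>R h - u) \<partial>lborel) =
      (\<integral>u. K (u /\<^sub>R h) * K (v /\<^sub>R h - u /\<^sub>R h) \<partial>lborel) / ?D"
    using lborel_integral_affine[of "\<lambda>u. K u * K (v /\<^sub>R h - u)" "inverse h" 0] h
    by (simp add: field_simps)
  moreover have "convolve (rescaled h K) (rescaled h K) v =
      (\<integral>u. K (u /\<^sub>R h) * K (v /\<^sub>R h - u /\<^sub>R h) \<partial>lborel) / (?D * ?D)"
    by (simp add: convolve_def rescaled_def scaleR_diff_right)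
  ultimately show "convolve (rescaled h K) (rescaled h K) v = 1 / ?D * convolve K K (v /\<^sub>R h)"
    by (simp add: convolve_def)
qed

section \<open>Square integrable functions and their pairing with kernels\<close>

lemma L2_add:
  assumes "f \<in> L2 M" "g \<in> L2 M"
  shows "(\<lambda>x. f x + g x) \<in> L2 M"
proof -
  have [measurable]: "f \<in> borel_measurable M" "g \<in> borel_measurable M"
    and f: "integrable M (\<lambda>x. (norm (f x))\<^sup>2)" and g: "integrable M (\<lambda>x. (norm (g x))\<^sup>2)"
    using assms by (auto simp: L2_def)
  have "integrable M (\<lambda>x. (norm (f x + g x))\<^sup>2)"
  proof (rule Bochner_Integration.integrable_bound)
    show "integrable M (\<lambda>x. 2 * (norm (f x))\<^sup>2 + 2 * (norm (g x))\<^sup>2)"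
      using f g by auto
    have "(norm (f x + g x))\<^sup>2 \<le> 2 * (norm (f x))\<^sup>2 + 2 * (norm (g x))\<^sup>2" for x
    proof -
      have "(norm (f x + g x))\<^sup>2 \<le> (norm (f x) + norm (g x))\<^sup>2"
        by (intro power_mono norm_triangle_ineq) auto
      also have "\<dots> \<le> 2 * (norm (f x))\<^sup>2 + 2 * (norm (g x))\<^sup>2"
        using sum_squares_bound[of "norm (f x)" "norm (g x)"] by (simp add: power2_sum)
      finally show ?thesis .
    qed
    then show "AE x in M. norm ((norm (f x + g x))\<^sup>2) \<le>
        norm (2 * (norm (f x))\<^sup>2 + 2 * (norm (g x))\<^sup>2)"
      by (intro AE_I2) (auto simp: order.trans[OF _ abs_ge_self])
  qed measurable
  then show ?thesis
    by (simp add: L2_def)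
qed

lemma L2_cmult: "f \<in> L2 M \<Longrightarrow> (\<lambda>x. c * f x) \<in> L2 M"
  by (auto simp: L2_def norm_mult power_mult_distrib)

lemma L2_sum:
  assumes "\<And>i. i \<in> I \<Longrightarrow> f i \<in> L2 M"
  shows "(\<lambda>x. \<Sum>i\<in>I. f i x) \<in> L2 M"
  using assms
proof (induction I rule: infinite_finite_induct)
  case (insert i I)
  then show ?case
    using L2_add[of "f i" M "\<lambda>x. \<Sum>i\<in>I. f i x"] by simp
qed (auto simp: L2_def)

text \<open>Where \<open>\<pi>\<close> is positive, the product is \<open>\<pi>\<close> times
  \<open>\<phi>\<close> times \<open>K / \<pi>\<close>, bounded by the weighted sum of the squares
  of the last two. Where \<open>\<pi>\<close> is 0, the quotient is 0 by convention and says nothing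
  about \<open>K\<close>; there \<open>zero\<close> takes over.\<close>

lemma integrable_L2_mult_weighted:
  fixes \<pi> :: "'a::euclidean_space \<Rightarrow> real" and \<phi> :: "'a \<Rightarrow> complex"
  assumes [measurable]: "\<pi> \<in> borel_measurable borel" and nn: "\<And>v. 0 \<le> \<pi> v"
    and \<phi>: "\<phi> \<in> L2 (weighted \<pi>)"
    and [measurable]: "K \<in> borel_measurable borel"
    and K: "(\<lambda>v. complex_of_real (K v / \<pi> v)) \<in> L2 (weighted \<pi>)"
    and zero: "AE v in lborel. \<pi> v = 0 \<longrightarrow> K v = 0"
  shows "integrable lborel (\<lambda>v. \<phi> v * complex_of_real (K v))"
proof -
  have [measurable]: "\<phi> \<in> borel_measurable borel"
    using \<phi> by (auto simp: L2_def)
  have "integrable (weighted \<pi>) (\<lambda>v. (norm (\<phi> v))\<^sup>2)" "integrable (weighted \<pi>) (\<lambda>v. (K v / \<pi> v)\<^sup>2)"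
    using \<phi> K by (auto simp: L2_def norm_divide power_divide)
  then have "integrable lborel (\<lambda>v. \<pi> v * (norm (\<phi> v))\<^sup>2)" "integrable lborel (\<lambda>v. \<pi> v * (K v / \<pi> v)\<^sup>2)"
    using nn by (simp_all add: integrable_density)
  then have "integrable lborel (\<lambda>v. \<pi> v * (norm (\<phi> v))\<^sup>2 + \<pi> v * (K v / \<pi> v)\<^sup>2)"
    by (rule Bochner_Integration.integrable_add)
  then show ?thesis
  proof (rule Bochner_Integration.integrable_bound)
    show "AE v in lborel. norm (\<phi> v * complex_of_real (K v)) \<le>
        norm (\<pi> v * (norm (\<phi> v))\<^sup>2 + \<pi> v * (K v / \<pi> v)\<^sup>2)"
      using zero
    proof eventually_elim
      case (elim v)
      show ?case
      proof (cases "\<pi> v = 0")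
        case False
        let ?a = "norm (\<phi> v)" and ?b = "\<bar>K v / \<pi> v\<bar>"
        have pos: "0 < \<pi> v"
          using False nn[of v] by simp
        have "?a * ?b \<le> ?a\<^sup>2 + ?b\<^sup>2"
          using sum_squares_bound[of ?a ?b] mult_nonneg_nonneg[OF norm_ge_zero abs_ge_zero, of "\<phi> v" "K v / \<pi> v"]
          by linarith
        then have "\<pi> v * (?a * ?b) \<le> \<pi> v * (?a\<^sup>2 + ?b\<^sup>2)"
          using pos by (intro mult_left_mono) auto
        moreover have "\<pi> v * (?a * ?b) = norm (\<phi> v * complex_of_real (K v))"
          using pos by (simp add: norm_mult abs_divide)
        moreover have "\<pi> v * (?a\<^sup>2 + ?b\<^sup>2) = \<pi> v * (norm (\<phi> v))\<^sup>2 + \<pi> v * (K v / \<pi> v)\<^sup>2"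
          by (simp only: distrib_left power2_abs)
        ultimately show ?thesis
          by simp
      qed (use elim in simp)
    qed
  qed simp
qed

lemma integral_double_sum:
  fixes d :: "'i \<Rightarrow> 'j \<Rightarrow> complex"
  assumes "\<And>i j. i \<in> I \<Longrightarrow> j \<in> J \<Longrightarrow> integrable M (G i j)"
  shows "(\<integral>x. (\<Sum>i\<in>I. \<Sum>j\<in>J. d i j * G i j x) \<partial>M) =
    (\<Sum>i\<in>I. \<Sum>j\<in>J. d i j * (\<integral>x. G i j x \<partial>M))"
  using assms by (simp add: Bochner_Integration.integral_sum Bochner_Integration.integrable_sum)

section \<open>The adjoint operators on finite sums\<close>

lemma A_hat_adj_trigonometric_sum:
  fixes w :: "nat \<Rightarrow> real^'q" and z :: "nat \<Rightarrow> real^'p"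
  assumes "finite_measure \<mu>" and id: "(\<lambda>t. t) \<in> borel_measurable \<mu>"
  shows "A_hat_adj \<mu> \<pi> n h K z w (\<lambda>t. \<Sum>i=1..n. c i * iexp (w i \<bullet> t)) v =
    (\<Sum>i=1..n. \<Sum>j=1..n. c i * complex_of_real (1 / (real n * h ^ CARD('p)) *
      (K ((v - z j) /\<^sub>R h) / \<pi> v)) * fourier \<mu> (w i - w j))"
proof -
  interpret finite_measure \<mu> by fact
  note [measurable] = id
  have int: "integrable \<mu> (\<lambda>t. iexp (u \<bullet> t))" for u :: "real^'q"
    by (rule integrable_const_bound[where B = 1]) (auto simp: norm_exp_i_times)
  have "(\<Sum>i=1..n. c i * iexp (w i \<bullet> t)) * (cnj (k_hat n h K z w v t) / complex_of_real (\<pi> v)) =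
      (\<Sum>i=1..n. \<Sum>j=1..n. c i * complex_of_real (1 / (real n * h ^ CARD('p)) *
        (K ((v - z j) /\<^sub>R h) / \<pi> v)) * iexp ((w i - w j) \<bullet> t))" for t
  proof -
    \<comment> \<open>The conjugate in the adjoint produces the difference of sample points at which
      the transform is evaluated.\<close>
    have e: "iexp ((w i - w j) \<bullet> t) = iexp (w i \<bullet> t) * cnj (iexp (w j \<bullet> t))" for i j
      by (simp add: exp_cnj inner_diff_left right_diff_distrib exp_diff exp_minus divide_inverse)
    have "cnj (k_hat n h K z w v t) / complex_of_real (\<pi> v) =
        (\<Sum>j=1..n. complex_of_real (1 / (real n * h ^ CARD('p)) *
          (K ((v - z j) /\<^sub>R h) / \<pi> v)) * cnj (iexp (w j \<bullet> t)))"
      unfolding k_hat_def by (simp add: sum_distrib_left sum_divide_distrib mult_ac)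
    then show ?thesis
      unfolding e by (simp only: sum_product mult.assoc mult.left_commute)
  qed
  then show ?thesis
    unfolding A_hat_adj_def fourier_def
    by (simp only: integral_double_sum[OF int])
qed

text \<open>The factor \<open>1 / hW ^ CARD('q)\<close> of \<open>f_hat\<close> is absorbed into
  \<open>k\<close>, so the right-hand side is literally the one obtained for trigonometric sums with
  the same coefficients \<open>c\<close>.\<close>

lemma T_hat_adj_kernel_sum:
  fixes w :: "nat \<Rightarrow> real^'q" and z :: "nat \<Rightarrow> real^'p" and KW hW
  defines "k \<equiv> rescaled hW KW"
  assumes int: "\<And>x y. integrable lborel (\<lambda>u. k (u - x) * k (u - y))"
    and F: "\<And>x y. complex_of_real (\<integral>u. k (u - x) * k (u - y) \<partial>lborel) = fourier \<mu> (x - y)"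
  shows "T_hat_adj \<pi> n h hW K KW z w (\<lambda>u. \<Sum>i=1..n. c i * complex_of_real (k (u - w i))) v =
    (\<Sum>i=1..n. \<Sum>j=1..n. c i * complex_of_real (1 / (real n * h ^ CARD('p)) *
      (K ((v - z j) /\<^sub>R h) / \<pi> v)) * fourier \<mu> (w i - w j))"
proof -
  have "(\<Sum>i=1..n. c i * complex_of_real (k (u - w i))) *
        complex_of_real (f_hat n h hW K KW z w u v * (1 / \<pi> v)) =
      (\<Sum>i=1..n. \<Sum>j=1..n. c i * complex_of_real (1 / (real n * h ^ CARD('p)) *
        (K ((v - z j) /\<^sub>R h) / \<pi> v)) * complex_of_real (k (u - w i) * k (u - w j)))" for u
  proof -
    have "f_hat n h hW K KW z w u v * (1 / \<pi> v) =
        (\<Sum>j=1..n. 1 / (real n * h ^ CARD('p)) * (K ((v - z j) /\<^sub>R h) / \<pi> v) * k (u - w j))"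
      unfolding f_hat_def k_def rescaled_def by (simp add: sum_distrib_left sum_divide_distrib mult_ac)
    then show ?thesis
      by (simp only: of_real_sum of_real_mult sum_product mult.assoc mult.left_commute)
  qed
  moreover have "integrable lborel (\<lambda>u. complex_of_real (k (u - w i) * k (u - w j)))" for i j
    using int by (rule integrable_of_real)
  ultimately show ?thesis
    unfolding T_hat_adj_def F[symmetric]
    by (simp only: integral_double_sum integral_complex_of_real)
qed

text \<open>The two compositions are known to agree only on \<open>L2 M\<close>, so the induction
  must also carry the membership of every iterate.\<close>

lemma landweber_eq:
  assumes s: "A' s = B' r" and mem: "A' s \<in> L2 M"
    and AB: "\<And>\<phi>. \<phi> \<in> L2 M \<Longrightarrow> A' (A \<phi>) = B' (B \<phi>)"
    and closed: "\<And>\<phi>. \<phi> \<in> L2 M \<Longrightarrow> A' (A \<phi>) \<in> L2 M"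
  shows "landweber a m A A' s = landweber a m B B' r"
proof -
  define S where "S \<phi> x = \<phi> x - complex_of_real a * A' (A \<phi>) x" for \<phi> x
  define S' where "S' \<phi> x = \<phi> x - complex_of_real a * B' (B \<phi>) x" for \<phi> x
  have "(S ^^ l) (A' s) = (S' ^^ l) (B' r) \<and> (S ^^ l) (A' s) \<in> L2 M" for l
  proof (induction l)
    case (Suc l)
    then have \<phi>: "(S ^^ l) (A' s) \<in> L2 M" and eq: "(S' ^^ l) (B' r) = (S ^^ l) (A' s)"
      by auto
    have "S ((S ^^ l) (A' s)) \<in> L2 M"
      using L2_add[OF \<phi> L2_cmult[OF closed[OF \<phi>], of "- complex_of_real a"]]
      by (simp add: S_def[abs_def])
    then show ?case
      using AB[OF \<phi>] eq by (simp add: S_def[abs_def] S'_def[abs_def])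
  qed (use s mem in simp)
  then show ?thesis
    unfolding landweber_def S_def[abs_def] S'_def[abs_def] by auto
qed

theorem mainTheorem4:
  fixes M :: "'o measure"
    and Y U :: "'o \<Rightarrow> real" and Z :: "'o \<Rightarrow> real^'p" and W :: "'o \<Rightarrow> real^'q"
    and \<phi>0 f_Z \<pi> K :: "real^'p \<Rightarrow> real" and KW :: "real^'q \<Rightarrow> real"
    and T :: "(real^'q) set" and \<mu> :: "(real^'q) measure"
    and n m :: nat and a h hW :: real
    and Ys :: "nat \<Rightarrow> 'o \<Rightarrow> real" and Zs :: "nat \<Rightarrow> 'o \<Rightarrow> real^'p" and Ws :: "nat \<Rightarrow> 'o \<Rightarrow> real^'q"
    and x :: 'o
  defines "y \<equiv> \<lambda>i. Ys i x" and "z \<equiv> \<lambda>i. Zs i x" and "w \<equiv> \<lambda>i. Ws i x"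
  defines "A \<equiv> A_hat n h K z w" and "A' \<equiv> A_hat_adj \<mu> \<pi> n h K z w" and "s \<equiv> s_hat n y w"
    and "B \<equiv> T_hat n h hW K KW z w" and "B' \<equiv> T_hat_adj \<pi> n h hW K KW z w"
    and "r \<equiv> r_hat n hW KW y w"
  (* the model *)
  assumes "prob_space M"
    and "Y \<in> borel_measurable M" and "Z \<in> borel_measurable M" and "W \<in> borel_measurable M"
    and "\<phi>0 \<in> borel_measurable borel"
    and "\<forall>x\<in>space M. Y x = \<phi>0 (Z x) + U x"
    and "integrable M U"
    and "AE x in M. real_cond_exp M (vimage_algebra (space M) W borel) U x = 0"
  (* the sample, observed at the outcome x *)
    and "n \<ge> 1"
    and "\<forall>i\<in>{1..n}. Ys i \<in> borel_measurable M \<and> Zs i \<in> borel_measurable M \<and> Ws i \<in> borel_measurable M"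
    and "\<forall>i\<in>{1..n}. distr M borel (\<lambda>x. (Ys i x, Zs i x, Ws i x)) = distr M borel (\<lambda>x. (Y x, Z x, W x))"
    and "x \<in> space M"
  (* the measure on T *)
    and "\<exists>S. open S \<and> 0 \<in> S \<and> S \<subseteq> T"
    and "sets \<mu> = sets (restrict_space borel T)"
    and "finite_measure \<mu>"
    and "\<forall>v. fourier \<mu> v = fourier \<mu> (- v)"
  (* the weight \<pi> *)
    and "prob_density \<pi>"
    and "\<forall>v \<in> measure_support (distr M borel Z). \<pi> v > 0"
    and "\<forall>v. f_Z v \<ge> 0" and "distributed M lborel Z (\<lambda>v. ennreal (f_Z v))"
    and "(\<lambda>v. complex_of_real (f_Z v / \<pi> v)) \<in> L2 (weighted \<pi>)"
  (* the regularization constant *)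
    and "0 < a" and "ennreal a < 1 / (op_norm (weighted \<pi>) \<mu> (A_op M Z W))\<^sup>2"
  (* kernels and bandwidths; the quotient K((. - Z_i)/h)/\<pi> is meaningful and lies in L2 *)
    and "smoothing_kernel K" and "\<forall>v. K (- v) = K v" and "h > 0"
    and "\<forall>i\<in>{1..n}. AE v in lborel. \<pi> v = 0 \<longrightarrow> K ((v - z i) /\<^sub>R h) = 0"
    and "\<forall>i\<in>{1..n}. (\<lambda>v. complex_of_real (K ((v - z i) /\<^sub>R h) / \<pi> v)) \<in> L2 (weighted \<pi>)"
    and "smoothing_kernel KW" and "hW > 0"
    and "\<forall>v. complex_of_real (1 / hW ^ CARD('q) * convolve KW KW (v /\<^sub>R hW)) = fourier \<mu> v"
  shows "(AE v in weighted \<pi>. A' s v = B' r v) \<and>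
         (\<forall>\<phi> \<in> L2 (weighted \<pi>). AE v in weighted \<pi>. A' (A \<phi>) v = B' (B \<phi>) v) \<and>
         (AE v in weighted \<pi>. landweber a m A A' s v = landweber a m B B' r v)"
proof -
  let ?k = "rescaled hW KW" and ?L = "L2 (weighted \<pi>)"
  let ?Ki = "\<lambda>i v. K ((v - z i) /\<^sub>R h)" and ?C = "1 / (real n * h ^ CARD('p))"
  note K_L2 = \<open>\<forall>i\<in>{1..n}. (\<lambda>v. complex_of_real (?Ki i v / \<pi> v)) \<in> ?L\<close>
  have id: "(\<lambda>t. t) \<in> borel_measurable \<mu>"
    using measurable_cong_sets[OF \<open>sets \<mu> = _\<close> refl, of borel] measurable_restrict_space1[of "\<lambda>t. t" borel borel T]
    by auto
  have KW: "integrable lborel KW" "(\<integral>u. KW u \<partial>lborel) = 1"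
    using \<open>smoothing_kernel KW\<close> by (auto simp: smoothing_kernel_def)
  have k: "integrable lborel ?k" "(\<integral>u. ?k u \<partial>lborel) \<noteq> 0"
    using KW \<open>hW > 0\<close> by (simp_all add: integrable_rescaled integral_rescaled)
  have F: "complex_of_real (convolve ?k ?k v) = fourier \<mu> v" for v
    using convolve_rescaled[OF KW(1) \<open>hW > 0\<close>, of v]
      \<open>\<forall>v. complex_of_real (1 / hW ^ CARD('q) * convolve KW KW (v /\<^sub>R hW)) = fourier \<mu> v\<close>
    by simp
  have sym: "fourier \<mu> v = fourier \<mu> (- v)" for v
    using \<open>\<forall>v. fourier \<mu> v = fourier \<mu> (- v)\<close> by blast
  note kk = convolve_self_fourier_integrable[OF k \<open>finite_measure \<mu>\<close> id F sym]
    convolve_self_fourier_integral[OF k \<open>finite_measure \<mu>\<close> id F sym]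
  have A'_eq: "A' (\<lambda>t. \<Sum>i=1..n. c i * iexp (w i \<bullet> t)) = (\<lambda>v. \<Sum>i=1..n. \<Sum>j=1..n.
      c i * complex_of_real (?C * (?Ki j v / \<pi> v)) * fourier \<mu> (w i - w j))" for c
    unfolding A'_def by (intro ext A_hat_adj_trigonometric_sum id) fact
  have B'_eq: "B' (\<lambda>u. \<Sum>i=1..n. c i * complex_of_real (?k (u - w i))) =
      A' (\<lambda>t. \<Sum>i=1..n. c i * iexp (w i \<bullet> t))" for c
    unfolding B'_def A'_eq by (intro ext T_hat_adj_kernel_sum kk)
  \<comment> \<open>As a function of \<open>v\<close> this is a finite combination of the quotients
    of shifted kernels by \<open>\<pi>\<close>, each of which is in \<open>?L\<close> by
    hypothesis.\<close>
  have A'_L2: "A' (\<lambda>t. \<Sum>i=1..n. c i * iexp (w i \<bullet> t)) \<in> ?L" for c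
  proof -
    have "(\<lambda>v. (c i * complex_of_real ?C * fourier \<mu> (w i - w j)) * complex_of_real (?Ki j v / \<pi> v)) \<in> ?L"
      if "j \<in> {1..n}" for i j
      using K_L2 that by (intro L2_cmult) blast
    then show ?thesis
      unfolding A'_eq by (intro L2_sum) (simp add: mult_ac)
  qed
  have s_eq: "s = (\<lambda>t. \<Sum>i=1..n. complex_of_real (y i / real n) * iexp (w i \<bullet> t))"
    unfolding s_def s_hat_def by (simp add: fun_eq_iff sum_distrib_left)
  have r_eq: "r = (\<lambda>u. \<Sum>i=1..n. complex_of_real (y i / real n) * complex_of_real (?k (u - w i)))"
    unfolding r_def r_hat_def rescaled_def by (simp add: fun_eq_iff sum_distrib_left mult_ac)
  have sr: "A' s = B' r"
    unfolding s_eq r_eq B'_eq ..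
  \<comment> \<open>The common coefficients of \<open>A \<phi>\<close> and \<open>B \<phi>\<close>:
    the two images differ only in whether \<open>c \<phi> i\<close> multiplies an exponential or a
    shifted kernel, exactly as \<open>s\<close> and \<open>r\<close> do with
    \<open>y i / real n\<close>.\<close>
  define c where "c \<phi> i = complex_of_real ?C * (\<integral>v. \<phi> v * complex_of_real (?Ki i v) \<partial>lborel)" for \<phi> i
  \<comment> \<open>This permits splitting the integrals over \<open>v\<close> into sums over the
    sample, and it is where \<open>\<phi>\<close> must be in \<open>?L\<close>.\<close>
  have int: "integrable lborel (\<lambda>v. \<phi> v * complex_of_real (?Ki i v))"
    if "\<phi> \<in> ?L" "i \<in> {1..n}" for \<phi> i
  proof (rule integrable_L2_mult_weighted[where \<pi> = \<pi>])
    have "integrable lborel K"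
      using \<open>smoothing_kernel K\<close> by (simp add: smoothing_kernel_def)
    then have [measurable]: "K \<in> borel_measurable borel"
      by auto
    show "?Ki i \<in> borel_measurable borel"
      by measurable
  qed (use \<open>prob_density \<pi>\<close> K_L2 \<open>\<forall>i\<in>{1..n}. AE v in lborel. \<pi> v = 0 \<longrightarrow> ?Ki i v = 0\<close> that
    in \<open>auto simp: prob_density_def\<close>)
  have A_eq: "A \<phi> = (\<lambda>t. \<Sum>i=1..n. c \<phi> i * iexp (w i \<bullet> t))" if "\<phi> \<in> ?L" for \<phi>
  proof
    fix t
    have "\<phi> v * k_hat n h K z w v t =
        (\<Sum>i=1..n. complex_of_real ?C * iexp (w i \<bullet> t) * (\<phi> v * complex_of_real (?Ki i v)))" for v
      unfolding k_hat_def by (simp add: sum_distrib_left mult_ac)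
    then have "A \<phi> t = (\<Sum>i=1..n. complex_of_real ?C * iexp (w i \<bullet> t) *
        (\<integral>v. \<phi> v * complex_of_real (?Ki i v) \<partial>lborel))"
      unfolding A_def A_hat_def using int[OF that] by (simp add: Bochner_Integration.integral_sum)
    then show "A \<phi> t = (\<Sum>i=1..n. c \<phi> i * iexp (w i \<bullet> t))"
      by (simp add: c_def mult_ac)
  qed
  have B_eq: "B \<phi> = (\<lambda>u. \<Sum>i=1..n. c \<phi> i * complex_of_real (?k (u - w i)))" if "\<phi> \<in> ?L" for \<phi>
  proof
    fix u
    have "\<phi> v * complex_of_real (f_hat n h hW K KW z w u v) =
        (\<Sum>i=1..n. complex_of_real (?C * ?k (u - w i)) * (\<phi> v * complex_of_real (?Ki i v)))" for v
      unfolding f_hat_def rescaled_def by (simp add: sum_distrib_left mult_ac)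
    then have "B \<phi> u = (\<Sum>i=1..n. complex_of_real (?C * ?k (u - w i)) *
        (\<integral>v. \<phi> v * complex_of_real (?Ki i v) \<partial>lborel))"
      unfolding B_def T_hat_def using int[OF that] by (simp add: Bochner_Integration.integral_sum)
    then show "B \<phi> u = (\<Sum>i=1..n. c \<phi> i * complex_of_real (?k (u - w i)))"
      by (simp add: c_def mult_ac)
  qed
  have AB: "A' (A \<phi>) = B' (B \<phi>)" and AA_L2: "A' (A \<phi>) \<in> ?L" if "\<phi> \<in> ?L" for \<phi>
    using that by (simp_all only: A_eq B_eq B'_eq A'_L2)
  have "A' s \<in> ?L"
    unfolding s_eq by (rule A'_L2)
  with sr have "landweber a m A A' s = landweber a m B B' r"
    by (intro landweber_eq[where M = "weighted \<pi>" and A = A and A' = A' and B = B and B' = B'] AB AA_L2)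
  then show ?thesis
    using sr AB by simp
qed

end
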